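(* Let $h:\mathbb{N}\to\mathbb{R}$ be any function with $h(n)\to\infty$ as $n\to\infty$. For $n\ge 1$ let $s$ be a uniformly random element of $\{0,1\}^n$. Then with high probability \[ \delta(s)\le h(n)\sqrt{n}, \] i.e. $\Pr[\delta(s)\le h(n)\sqrt{n}]\to 1$ as $n\to\infty$.
   Context: A word is a shuffle square if it can be partitioned into two disjoint identical subsequences; that is, a word $w=w_1\cdots w_{2m}$ of even length $2m$ is a shuffle square if $\{1,\dots,2m\}$ can be partitioned into $I=\{i_1<\cdots<i_m\}$ and $J=\{j_1<\cdots<j_m\}$ with $w_{i_r}=w_{j_r}$ for all $1\le r\le m$ (the empty word is trivially a shuffle square). For $s\in\{0,1\}^n$, $\delta(s)$ is the smallest number of bits that can be removed (from arbitrary positions) from $s$ so that the remaining subsequence is a shuffle square. "With high probability" means with probability $1-o(1)$ as $n\to\infty$. *)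

theory Defs
  imports "HOL-Probability.Probability"
begin

text \<open>
  Positions are counted from 0. The list \<open>nths w I\<close> is the subsequence of \<open>w\<close> read off in
  increasing order at the positions in \<open>I\<close>, so \<open>nths w I = nths w J\<close> says that
  \<open>I = {i\<^sub>1 < \<dots> < i\<^sub>m}\<close> and \<open>J = {j\<^sub>1 < \<dots> < j\<^sub>m}\<close> have the same size \<open>m\<close> and that the
  letters of \<open>w\<close> at \<open>i\<^sub>r\<close> and \<open>j\<^sub>r\<close> agree for every \<open>r\<close>. In particular \<open>w\<close> has even length.
\<close>

definition shuffle_square :: "'a list \<Rightarrow> bool" where
  "shuffle_square w \<longleftrightarrow>
     (\<exists>I J. I \<union> J = {..<length w} \<and> I \<inter> J = {} \<and> nths w I = nths w J)"

text \<open>Here \<open>R\<close> is the set of removed positions.\<close>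

definition shuffle_deletion :: "'a list \<Rightarrow> nat" where
  "shuffle_deletion s =
     (LEAST k. \<exists>R \<subseteq> {..<length s}. card R = k \<and> shuffle_square (nths s ({..<length s} - R)))"

lemma shuffle_square_Nil: "shuffle_square []"
  by (simp add: shuffle_square_def)

lemma shuffle_square_even_length:
  assumes "shuffle_square w"
  shows "even (length w)"
proof -
  obtain I J where IJ: "I \<union> J = {..<length w}" "I \<inter> J = {}" "nths w I = nths w J"
    using assms by (auto simp: shuffle_square_def)
  have fin: "finite I" "finite J"
    using IJ(1) by (metis finite_Un finite_lessThan)+
  have "{i. i < length w \<and> i \<in> I} = I" "{i. i < length w \<and> i \<in> J} = J"
    using IJ(1) by auto
  then have "card I = card J"
    using IJ(3) by (metis length_nths)
  moreover have "length w = card I + card J"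
    using IJ(1,2) fin by (metis card_Un_disjoint card_lessThan)
  ultimately show ?thesis by simp
qed

text \<open>Removing everything leaves the empty word, so the minimum in \<open>shuffle_deletion\<close> is attained.\<close>

lemma shuffle_deletion_attained:
  "\<exists>R \<subseteq> {..<length s}. card R = shuffle_deletion s \<and>
     shuffle_square (nths s ({..<length s} - R))"
  unfolding shuffle_deletion_def
  by (rule LeastI[where k = "length s"])
     (rule exI[where x = "{..<length s}"], simp add: shuffle_square_Nil)

end

theory Submission
  imports Defs
begin

text \<open>
  Read \<open>s\<close> from left to right with a first-in-first-out queue: a letter equal to the head of the
  queue pops it, any other letter is pushed. Popped and popping letters form two identical
  subsequences, so it suffices to delete the letters left in the queue. On random bits the
  length of the queue is a reflected simple random walk, so the mean of its square after \<open>n\<close> steps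
  is exactly \<open>n\<close>, and Chebyshev's inequality bounds the probability of ending above
  \<open>h(n) \<surd>n\<close> by \<open>1 / h(n)\<^sup>2\<close>.
\<close>

text \<open>Links the inductive \<open>shuffles\<close> to the index sets of
  \<open>shuffle_square\<close>. The first letter of \<open>w\<close> comes from \<open>u\<close> or
  from \<open>v\<close>; position 0 joins the corresponding set, and the positions obtained for the
  tail move up by \<open>Suc\<close>.\<close>

lemma shuffles_imp_nths_partition:
  "w \<in> shuffles u v \<Longrightarrow>
     \<exists>I J. I \<union> J = {..<length w} \<and> I \<inter> J = {} \<and> nths w I = u \<and> nths w J = v"
proof (induction w arbitrary: u v)
  case Nil
  then show ?case by auto
next
  case (Cons x w)
  have shift: "{j. Suc j \<in> insert 0 (Suc ` K)} = K" "{j. Suc j \<in> Suc ` K} = K" for K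
    by auto
  from Cons.prems consider
      (left) u' where "u = x # u'" "w \<in> shuffles u' v"
    | (right) v' where "v = x # v'" "w \<in> shuffles u v'"
    by (cases u; cases v) (auto simp: Cons_in_shuffles_iff)
  then show ?case
  proof cases
    case left
    then obtain I J where IJ: "I \<union> J = {..<length w}" "I \<inter> J = {}"
        and nths: "nths w I = u'" "nths w J = v"
      using Cons.IH by blast
    have "{..<length (x # w)} = insert 0 (Suc ` (I \<union> J))"
      by (simp add: IJ(1) lessThan_Suc_eq_insert_0)
    then have "insert 0 (Suc ` I) \<union> Suc ` J = {..<length (x # w)}"
      by (simp only: image_Un Un_insert_left)
    moreover have "insert 0 (Suc ` I) \<inter> Suc ` J = {}"
      using IJ(2) by auto
    moreover have "nths (x # w) (insert 0 (Suc ` I)) = u" "nths (x # w) (Suc ` J) = v"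
      unfolding nths_Cons shift by (auto simp: left(1) nths)
    ultimately show ?thesis by blast
  next
    case right
    then obtain I J where IJ: "I \<union> J = {..<length w}" "I \<inter> J = {}"
        and nths: "nths w I = u" "nths w J = v'"
      using Cons.IH by blast
    have "{..<length (x # w)} = insert 0 (Suc ` (I \<union> J))"
      by (simp add: IJ(1) lessThan_Suc_eq_insert_0)
    then have "Suc ` I \<union> insert 0 (Suc ` J) = {..<length (x # w)}"
      by (simp only: image_Un Un_insert_right)
    moreover have "Suc ` I \<inter> insert 0 (Suc ` J) = {}"
      using IJ(2) by auto
    moreover have "nths (x # w) (Suc ` I) = u" "nths (x # w) (insert 0 (Suc ` J)) = v"
      unfolding nths_Cons shift by (auto simp: right(1) nths)
    ultimately show ?thesis by blast
  qed
qed

lemma shuffle_square_if_in_shuffles: "w \<in> shuffles u u \<Longrightarrow> shuffle_square w"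
  unfolding shuffle_square_def using shuffles_imp_nths_partition by metis

lemma shuffle_deletion_le:
  assumes "subseq w s" "shuffle_square w"
  shows "shuffle_deletion s \<le> length s - length w"
proof -
  obtain N where N: "w = nths s N"
    using assms(1) by (auto simp: subseq_conv_nths)
  \<comment> \<open>\<open>N\<close> may contain indices past the end of \<open>s\<close>, which
    \<open>nths\<close> ignores; without them the cardinality equals \<open>length w\<close>, and
    the complement is the set to remove.\<close>
  define K where "K = N \<inter> {..<length s}"
  have w: "w = nths s K"
    unfolding N K_def nths_def
    by (intro arg_cong[where f = "map fst"] filter_cong) (auto dest: set_zip_rightD)
  have "{i. i < length s \<and> i \<in> K} = K"
    by (auto simp: K_def)
  then have "length w = card K"
    by (simp add: w length_nths)
  moreover have "{..<length s} - ({..<length s} - K) = K"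
    by (auto simp: K_def)
  ultimately show ?thesis
    unfolding shuffle_deletion_def using assms(2) w
    by (intro Least_le exI[of _ "{..<length s} - K"]) (auto simp: card_Diff_subset K_def)
qed

text \<open>Letters deleted from one component can be deleted from the shuffle at the places where
  they were merged in. This serves to discard the letters still queued at the end.\<close>

lemma subseq_of_shuffle:
  "w \<in> shuffles u v \<Longrightarrow> subseq u' u \<Longrightarrow> \<exists>w' \<in> shuffles u' v. subseq w' w"
proof (induction w arbitrary: u u' v)
  case Nil
  then show ?case by auto
next
  case (Cons x w)
  from Cons.prems(1) consider
      (left) u1 where "u = x # u1" "w \<in> shuffles u1 v"
    | (right) v1 where "v = x # v1" "w \<in> shuffles u v1"
    by (cases u; cases v) (auto simp: Cons_in_shuffles_iff)
  then show ?case
  proof cases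
    case left
    from Cons.prems(2) consider "subseq u' u1" | u2 where "u' = x # u2" "subseq u2 u1"
      unfolding left(1) by (cases rule: list_emb.cases) auto
    then show ?thesis
    proof cases
      case 1
      then show ?thesis
        using Cons.IH[OF left(2)] by blast
    next
      case 2
      then obtain w' where "w' \<in> shuffles u2 v" "subseq w' w"
        using Cons.IH[OF left(2)] by blast
      then show ?thesis
        using 2 by (intro bexI[of _ "x # w'"]) (auto intro: Cons_in_shuffles_leftI)
    qed
  next
    case right
    then obtain w' where "w' \<in> shuffles u' v1" "subseq w' w"
      using Cons.IH Cons.prems(2) by blast
    then show ?thesis
      using right by (intro bexI[of _ "x # w'"]) (auto intro: Cons_in_shuffles_rightI)
  qed
qed

definition queue_step :: "'a list \<Rightarrow> 'a \<Rightarrow> 'a list" where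
  "queue_step q x = (if q \<noteq> [] \<and> hd q = x then tl q else q @ [x])"

text \<open>Here \<open>a\<close> lists the pushed and \<open>b\<close> the popped letters.
  First-in-first-out order makes the initial content followed by all pushes equal to all pops
  followed by the final content. The initial queue is arbitrary because the induction strips the
  first letter of \<open>s\<close>.\<close>

lemma queue_invariant:
  "\<exists>a b. s \<in> shuffles a b \<and> q @ a = b @ foldl queue_step q s"
proof (induction s arbitrary: q)
  case Nil
  show ?case by auto
next
  case (Cons x s)
  obtain a b where ab: "s \<in> shuffles a b"
    "queue_step q x @ a = b @ foldl queue_step (queue_step q x) s"
    using Cons.IH by blast
  show ?case
  proof (cases "q \<noteq> [] \<and> hd q = x")
    case True
    then have "q @ a = (x # b) @ foldl queue_step q (x # s)"
      using ab(2) by (cases q) (auto simp: queue_step_def)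
    then show ?thesis
      using Cons_in_shuffles_rightI[OF ab(1)] by (intro exI[of _ a] exI[of _ "x # b"] conjI)
  next
    case False
    then have "q @ (x # a) = b @ foldl queue_step q (x # s)"
      using ab(2) by (auto simp: queue_step_def)
    then show ?thesis
      using Cons_in_shuffles_leftI[OF ab(1)] by (intro exI[of _ "x # a"] exI[of _ b] conjI)
  qed
qed

lemma shuffle_deletion_le_queue:
  "shuffle_deletion s \<le> length (foldl queue_step [] s)"
proof -
  \<comment> \<open>Starting from the empty queue, the pushed word is the popped word
    \<open>u\<close> followed by the final queue; dropping that suffix leaves a shuffle of
    \<open>u\<close> with itself.\<close>
  obtain u where u: "s \<in> shuffles (u @ foldl queue_step [] s) u"
    using queue_invariant[of s "[]"] by auto
  then obtain w where w: "w \<in> shuffles u u" "subseq w s"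
    using subseq_of_shuffle[OF u, of u] by auto
  have "shuffle_deletion s \<le> length s - length w"
    using w shuffle_deletion_le shuffle_square_if_in_shuffles by blast
  also have "\<dots> = length (foldl queue_step [] s)"
    using length_shuffles[OF u] length_shuffles[OF w(1)] by simp
  finally show ?thesis .
qed

lemma finite_bool_lists: "finite {s :: bool list. length s = n}"
  using finite_lists_length_eq[of "UNIV :: bool set" n] by simp

lemma card_bool_lists: "card {s :: bool list. length s = n} = 2 ^ n"
  using card_lists_length_eq[of "UNIV :: bool set" n] by simp

lemma sum_bool_lists_Suc:
  fixes f :: "bool list \<Rightarrow> 'b :: comm_monoid_add"
  shows "(\<Sum>s | length s = Suc n. f s) =
           (\<Sum>s | length s = n. f (True # s)) + (\<Sum>s | length s = n. f (False # s))"
proof -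
  have "{s :: bool list. length s = Suc n} =
          Cons True ` {s. length s = n} \<union> Cons False ` {s. length s = n}"
    by (auto simp: length_Suc_conv image_iff)
  then have "(\<Sum>s | length s = Suc n. f s) =
      sum f (Cons True ` {s. length s = n}) + sum f (Cons False ` {s. length s = n})"
    by (simp only:) (rule sum.union_disjoint, auto simp: finite_bool_lists)
  then show ?thesis
    by (simp add: sum.reindex)
qed

text \<open>Averaged over the next bit, the squared length grows by exactly 1 per step, whatever the
  current queue.\<close>

lemma sum_queue_length_squared:
  "(\<Sum>s | length s = n. (real (length (foldl queue_step (q :: bool list) s)))\<^sup>2) =
     2 ^ n * ((real (length q))\<^sup>2 + real n)"
proof (induction n arbitrary: q)
  case 0
  show ?case by simp
next
  case (Suc n)
  \<comment> \<open>A queue of length k > 0 moves to k - 1 or k + 1, with squares summing to 2k^2 +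
    2. From the empty queue both bits lead to length 1, and the sum 2 fits the same formula, so
    reflection costs nothing.\<close>
  have "(real (length (queue_step q True)))\<^sup>2 + (real (length (queue_step q False)))\<^sup>2 =
          2 * (real (length q))\<^sup>2 + 2"
    by (cases q; cases "hd q") (auto simp: queue_step_def power2_eq_square algebra_simps)
  then have "2 ^ n * ((real (length (queue_step q True)))\<^sup>2 +
               (real (length (queue_step q False)))\<^sup>2) =
             2 ^ n * (2 * (real (length q))\<^sup>2 + 2)"
    by (simp only:)
  then show ?case
    by (simp add: sum_bool_lists_Suc Suc.IH algebra_simps)
qed

lemma prob_shuffle_deletion_ge:
  assumes "c > 0" "n > 0"
  shows "measure_pmf.prob (pmf_of_set {s :: bool list. length s = n})
           {s. real (shuffle_deletion s) \<le> c * sqrt (real n)} \<ge> 1 - 1 / c\<^sup>2"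
proof -
  let ?S = "{s :: bool list. length s = n}"
  let ?L = "\<lambda>s :: bool list. real (length (foldl queue_step [] s))"
  define t where "t = c * sqrt (real n)"
  define B where "B = {s \<in> ?S. ?L s > t}"
  have t: "t > 0" "t\<^sup>2 = c\<^sup>2 * real n"
    using assms by (auto simp: t_def power_mult_distrib)
  \<comment> \<open>Chebyshev's inequality in counting form: every word in \<open>B\<close>
    contributes at least \<open>t\<^sup>2\<close> to the total of the squared lengths.\<close>
  have "real (card B) * t\<^sup>2 = (\<Sum>s\<in>B. t\<^sup>2)"
    by simp
  also have "\<dots> \<le> (\<Sum>s\<in>B. (?L s)\<^sup>2)"
    using t(1) by (intro sum_mono power_mono) (auto simp: B_def)
  also have "\<dots> \<le> (\<Sum>s\<in>?S. (?L s)\<^sup>2)"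
    by (intro sum_mono2 finite_bool_lists) (auto simp: B_def)
  also have "\<dots> = 2 ^ n * real n"
    by (simp add: sum_queue_length_squared)
  finally have "real (card B) / 2 ^ n \<le> 1 / c\<^sup>2"
    using assms by (simp add: t(2) field_simps)
  moreover have "real (card (?S - B)) = 2 ^ n - real (card B)"
  proof -
    have "B \<subseteq> ?S" by (auto simp: B_def)
    then have "card (?S - B) = 2 ^ n - card B" "card B \<le> 2 ^ n"
      using card_Diff_subset[of B ?S] card_mono[of ?S B] finite_subset[of B ?S]
      by (simp_all add: finite_bool_lists card_bool_lists)
    then show ?thesis by (simp add: of_nat_diff)
  qed
  ultimately have "1 - 1 / c\<^sup>2 \<le> real (card (?S - B)) / card ?S"
    by (simp add: card_bool_lists diff_divide_distrib)
  also have "\<dots> \<le> real (card (?S \<inter> {s. real (shuffle_deletion s) \<le> t})) / card ?S"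
  proof -
    have "?S - B \<subseteq> ?S \<inter> {s. real (shuffle_deletion s) \<le> t}"
    proof
      fix s
      assume "s \<in> ?S - B"
      then have "s \<in> ?S" "?L s \<le> t"
        by (auto simp: B_def)
      moreover have "real (shuffle_deletion s) \<le> ?L s"
        by (simp add: shuffle_deletion_le_queue)
      ultimately show "s \<in> ?S \<inter> {s. real (shuffle_deletion s) \<le> t}"
        by simp
    qed
    then show ?thesis
      by (intro divide_right_mono of_nat_mono card_mono) (auto simp: finite_bool_lists)
  qed
  also have "\<dots> = measure_pmf.prob (pmf_of_set ?S) {s. real (shuffle_deletion s) \<le> t}"
  proof (rule measure_pmf_of_set[symmetric])
    show "?S \<noteq> {}" using card_bool_lists[of n] by (metis card.empty power_not_zero zero_neq_numeral)
  qed (rule finite_bool_lists)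
  finally show ?thesis by (simp add: t_def)
qed

theorem theorem1p4:
  fixes h :: "nat \<Rightarrow> real"
  assumes "filterlim h at_top sequentially"
  shows "(\<lambda>n. measure_pmf.prob (pmf_of_set {s :: bool list. length s = n})
            {s. real (shuffle_deletion s) \<le> h n * sqrt (real n)}) \<longlonglongrightarrow> 1"
proof (rule tendsto_sandwich[where h = "\<lambda>_. 1"])
  have "((\<lambda>n. 1 - 1 / (h n)\<^sup>2) \<longlongrightarrow> 1 - 0) sequentially"
    using assms
    by (intro tendsto_diff tendsto_const tendsto_divide_0 filterlim_at_top_imp_at_infinity
        filterlim_pow_at_top) auto
  then show "(\<lambda>n. 1 - 1 / (h n)\<^sup>2) \<longlonglongrightarrow> 1"
    by simp
  show "\<forall>\<^sub>F n in sequentially. 1 - 1 / (h n)\<^sup>2 \<le>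
          measure_pmf.prob (pmf_of_set {s :: bool list. length s = n})
            {s. real (shuffle_deletion s) \<le> h n * sqrt (real n)}"
    \<comment> \<open>\<open>h\<close> may be nonpositive at first; the Chebyshev bound is applied
      only once both \<open>h n\<close> and \<open>n\<close> are positive.\<close>
    using filterlim_at_top_dense[THEN iffD1, OF assms, rule_format, of 0] eventually_gt_at_top[of 0]
    by eventually_elim (rule prob_shuffle_deletion_ge)
qed simp_all

end
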